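(* Let $G$ be a digraph of order $n\ge 2$ and let $c>0$ be a real number such that for any pair of distinct vertices $x,y$ of $G$, at least $cn$ vertices of $G$ have a different distance to $x$ and to $y$ (that is, at least $cn$ vertices $z\in V(G)$ satisfy $d(z,x)\ne d(z,y)$). Then $$\beta(G)\le\frac{1+2\log n}{c}.$$
   Context: All digraphs are finite, simple and oriented (no loops, at most one arc between any two distinct vertices), and need not be strongly connected. $d(u,v)$ is the length of a shortest directed path from $u$ to $v$, and $d(u,v)=\infty$ if there is no such path. $\log$ is the natural logarithm. The parameter $c$ need not be constant (it may depend on $n$ and $G$). The metric dimension $\beta(G)$ is the least positive integer $k$ for which there are $k$ vertices $u_1,\dots,u_k$ such that the vectors $(d(u_1,x),\ldots,d(u_k,x))$, $x\in V(G)$, with entries in $\{0,1,2,\ldots\}\cup\{\infty\}$, are pairwise distinct. (Equivalently, it is the minimum number of cops needed to win the Localization game on $G$ in one round.) *)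

theory Defs
  imports Complex_Main "HOL-Library.Extended_Nat" "Graph_Theory.Shortest_Path"
begin

locale oriented_digraph = digraph +
  assumes no_antiparallel: "(u, v) \<in> arcs_ends G \<Longrightarrow> (v, u) \<notin> arcs_ends G"

text \<open>The infimum over the empty set in \<^typ>\<open>enat\<close> is \<open>\<infinity>\<close>.\<close>

definition path_dist :: "('a, 'b) pre_digraph \<Rightarrow> 'a \<Rightarrow> 'a \<Rightarrow> enat" where
  "path_dist G u v = (INF p \<in> {p. pre_digraph.apath G u p v}. enat (length p))"

definition resolving :: "('a, 'b) pre_digraph \<Rightarrow> 'a list \<Rightarrow> bool" where
  "resolving G us \<longleftrightarrow> distinct us \<and> set us \<subseteq> verts G \<and>
     inj_on (\<lambda>x. map (\<lambda>u. path_dist G u x) us) (verts G)"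

text \<open>The positivity requirement only matters for graphs with at most one vertex.\<close>

definition metric_dimension :: "('a, 'b) pre_digraph \<Rightarrow> nat" where
  "metric_dimension G = (LEAST k. 0 < k \<and> (\<exists>us. length us = k \<and> resolving G us))"

text \<open>The distance agrees with the library's weighted distance for unit weights.\<close>

lemma (in fin_digraph) path_dist_eq_\<mu>:
  "ereal_of_enat (path_dist G u v) = \<mu> (\<lambda>_. 1) u v"
proof -
  have cost: "awalk_cost (\<lambda>_. 1) p = real (length p)" for p
    by (induction p) auto
  show ?thesis
  proof (cases "u \<rightarrow>\<^sup>*\<^bsub>G\<^esub> v")
    case False
    then have "{p. apath u p v} = {}"
      by (auto simp: reachable_apath)
    then have "path_dist G u v = \<infinity>"
      by (simp add: path_dist_def top_enat_def)
    with False show ?thesis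
      by (simp add: shortest_path_inf)
  next
    case True
    then obtain p where p: "apath u p v" "\<mu> (\<lambda>_. 1) u v = ereal (real (length p))"
      using min_cost_awalk[of u v "\<lambda>_. 1"] by (auto simp: cost)
    have "length p \<le> length q" if "apath u q v" for q
      using min_cost_le_walk_cost[of u q v "\<lambda>_. 1"] that p by (auto simp: cost apath_def)
    with p have "path_dist G u v = enat (length p)"
      unfolding path_dist_def by (intro antisym INF_lower INF_greatest) (auto intro: INF_lower2)
    with p show ?thesis
      by simp
  qed
qed

lemma (in fin_digraph) path_dist_eq_0_iff:
  assumes "u \<in> verts G"
  shows "path_dist G u v = 0 \<longleftrightarrow> u = v"
proof
  assume "u = v"
  then have "apath u [] v"
    using assms by (simp add: apath_Nil_iff)
  then have "path_dist G u v \<le> enat (length ([] :: 'b list))"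
    unfolding path_dist_def by (intro INF_lower) simp
  then show "path_dist G u v = 0"
    by (simp add: zero_enat_def[symmetric])
next
  assume "path_dist G u v = 0"
  then have "path_dist G u v < 1"
    by simp
  then obtain p where "apath u p v" "enat (length p) < 1"
    unfolding path_dist_def by (auto simp: INF_less_iff)
  then show "u = v"
    by (auto simp: one_enat_def apath_Nil_iff)
qed

text \<open>Hence the minimum defining \<^const>\<open>metric_dimension\<close> is attained
  whenever there is at least one vertex.\<close>

lemma (in fin_digraph) ex_resolving:
  obtains us where "resolving G us" "set us = verts G"
proof -
  obtain us where us: "set us = verts G" "distinct us"
    using finite_distinct_list[OF finite_verts] by blast
  have "inj_on (\<lambda>x. map (\<lambda>u. path_dist G u x) us) (verts G)"
  proof (rule inj_onI)
    fix x y assume xy: "x \<in> verts G" "y \<in> verts G"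
      and "map (\<lambda>u. path_dist G u x) us = map (\<lambda>u. path_dist G u y) us"
    then have "path_dist G x x = path_dist G x y"
      using us by (simp add: map_eq_conv)
    with xy show "x = y"
      using path_dist_eq_0_iff by metis
  qed
  with us show thesis
    by (intro that[of us]) (auto simp: resolving_def)
qed

end

theory Submission
  imports Defs
begin

text \<open>
  A set of vertices resolves \<open>G\<close> iff it meets, for every pair of distinct vertices, the set of
  those vertices whose distances to the two differ. By hypothesis each of these sets contains a
  fraction at least \<open>c\<close> of all \<open>n\<close> vertices, so the bound is an instance of the greedy estimate for
  hitting sets: averaging over the vertices, some vertex separates a fraction at least \<open>c\<close> of
  the pairs that are not separated yet. Hence \<open>k\<close> greedy choices leave at most
  \<open>(1 - c)^k\<close> times the number of pairs, which is less than \<open>exp (- c k) n\<^sup>2\<close>. For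
  \<open>k = \<lceil>2 ln n / c\<rceil>\<close> this is at most 1, so no pair is left.
  Finally \<open>k \<le> 2 ln n / c + 1\<close>, and the rounding error 1 is at most \<open>1 / c\<close>, because a
  separating set cannot have more than \<open>n\<close> elements and therefore \<open>c \<le> 1\<close>.
\<close>

text \<open>The averaging step: in the incidence relation between \<open>V\<close> and \<open>P\<close> every \<open>p\<close> has at
  least \<open>c * card V\<close> incidences, so counting all incidences along \<open>V\<close> instead gives an element
  with at least \<open>c * card P\<close> of them.\<close>

lemma popular_element_exists:
  fixes R :: "'p \<Rightarrow> 'v set" and c :: real
  assumes "finite V" "V \<noteq> {}" "finite P"
    and R: "\<And>p. p \<in> P \<Longrightarrow> R p \<subseteq> V"
    and large: "\<And>p. p \<in> P \<Longrightarrow> c * real (card V) \<le> real (card (R p))"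
  shows "\<exists>v \<in> V. c * real (card P) \<le> real (card {p \<in> P. v \<in> R p})"
proof (rule ccontr)
  assume "\<not> ?thesis"
  then have few: "real (card {p \<in> P. v \<in> R p}) < c * real (card P)" if "v \<in> V" for v
    using \<open>v \<in> V\<close> by (simp add: not_le)
  have "(\<Sum>v\<in>V. card {p \<in> P. v \<in> R p}) = (\<Sum>p\<in>P. card {v \<in> V. v \<in> R p})"
    using assms by (intro sum_multicount_gen) auto
  also have "\<dots> = (\<Sum>p\<in>P. card (R p))"
    using R by (intro sum.cong refl arg_cong[of _ _ card]) auto
  finally have swap: "(\<Sum>v\<in>V. real (card {p \<in> P. v \<in> R p})) = (\<Sum>p\<in>P. real (card (R p)))"
    unfolding of_nat_sum[symmetric] by (rule arg_cong)
  have "(\<Sum>v\<in>V. real (card {p \<in> P. v \<in> R p})) < (\<Sum>v\<in>V. c * real (card P))"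
    using assms few by (intro sum_strict_mono) auto
  also have "\<dots> = (\<Sum>p\<in>P. c * real (card V))"
    by simp
  also have "\<dots> \<le> (\<Sum>p\<in>P. real (card (R p)))"
    using large by (rule sum_mono)
  finally show False
    using swap by simp
qed

text \<open>An element that lies in many of the sets still missed is chosen at each step, so each step
  multiplies their number by at most \<open>1 - c\<close>.\<close>

lemma greedy_hitting_set:
  fixes R :: "'p \<Rightarrow> 'v set" and c :: real
  assumes "finite V" "V \<noteq> {}" "finite P" "c \<le> 1"
    and R: "\<And>p. p \<in> P \<Longrightarrow> R p \<subseteq> V"
    and large: "\<And>p. p \<in> P \<Longrightarrow> c * real (card V) \<le> real (card (R p))"
  shows "\<exists>S \<subseteq> V. card S \<le> k \<and>
           real (card {p \<in> P. R p \<inter> S = {}}) \<le> (1 - c) ^ k * real (card P)"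
proof (induction k)
  case 0
  show ?case
    by (intro exI[of _ "{}"]) simp
next
  case (Suc k)
  then obtain S where S: "S \<subseteq> V" "card S \<le> k"
    and missed: "real (card {p \<in> P. R p \<inter> S = {}}) \<le> (1 - c) ^ k * real (card P)"
    by blast
  define U where "U = {p \<in> P. R p \<inter> S = {}}"
  have "finite U"
    using assms by (simp add: U_def)
  obtain v where v: "v \<in> V" "c * real (card U) \<le> real (card {p \<in> U. v \<in> R p})"
    using popular_element_exists[of V U R c] assms \<open>finite U\<close> by (auto simp: U_def)
  have "{p \<in> P. R p \<inter> insert v S = {}} = U - {p \<in> U. v \<in> R p}"
    by (auto simp: U_def)
  then have "real (card {p \<in> P. R p \<inter> insert v S = {}}) = real (card U) - real (card {p \<in> U. v \<in> R p})"
    using \<open>finite U\<close> by (simp add: card_Diff_subset card_mono of_nat_diff)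
  also have "\<dots> \<le> (1 - c) * real (card U)"
    using v by (simp add: algebra_simps)
  also have "\<dots> \<le> (1 - c) * ((1 - c) ^ k * real (card P))"
    using missed \<open>c \<le> 1\<close> by (intro mult_left_mono) (auto simp: U_def)
  finally have "real (card {p \<in> P. R p \<inter> insert v S = {}}) \<le> (1 - c) ^ Suc k * real (card P)"
    by simp
  moreover have "card (insert v S) \<le> Suc k"
    using S card_insert_le_m1[of "Suc k" S v] by simp
  ultimately show ?case
    using S v by (intro exI[of _ "insert v S"]) auto
qed

text \<open>The hitting condition is reached once the integer number of missed sets drops below 1;
  by \<open>1 - c \<le> exp (- c)\<close> this takes at most \<open>\<lceil>ln m / c\<rceil>\<close> greedy steps.\<close>

lemma small_hitting_set:
  fixes R :: "'p \<Rightarrow> 'v set" and c m :: real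
  assumes "finite V" "V \<noteq> {}" "finite P" "0 < c" "c \<le> 1"
    and "\<And>p. p \<in> P \<Longrightarrow> R p \<subseteq> V"
    and "\<And>p. p \<in> P \<Longrightarrow> c * real (card V) \<le> real (card (R p))"
    and m: "real (card P) < m" "1 \<le> m"
  shows "\<exists>S \<subseteq> V. real (card S) \<le> (1 + ln m) / c \<and> (\<forall>p \<in> P. R p \<inter> S \<noteq> {})"
proof -
  define k where "k = nat \<lceil>ln m / c\<rceil>"
  have "0 \<le> ln m / c"
    using assms by simp
  then have k: "ln m / c \<le> real k" "real k \<le> ln m / c + 1"
    unfolding k_def by linarith+
  obtain S where S: "S \<subseteq> V" "card S \<le> k"
    and missed: "real (card {p \<in> P. R p \<inter> S = {}}) \<le> (1 - c) ^ k * real (card P)"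
    using greedy_hitting_set[of V P c R k] assms by blast
  have "(1 - c) ^ k \<le> exp (- c) ^ k"
    using \<open>c \<le> 1\<close> exp_ge_add_one_self[of "- c"] by (intro power_mono) auto
  also have "\<dots> = exp (- (c * real k))"
    by (simp flip: exp_of_nat_mult add: mult.commute)
  also have "\<dots> \<le> exp (- ln m)"
    using k \<open>0 < c\<close> by (simp add: field_simps)
  also have "\<dots> = 1 / m"
    using m by (simp add: exp_minus inverse_eq_divide)
  finally have "(1 - c) ^ k * real (card P) \<le> 1 / m * real (card P)"
    by (rule mult_right_mono) simp
  also have "\<dots> < 1"
    using m by simp
  finally have "card {p \<in> P. R p \<inter> S = {}} = 0"
    using missed by linarith
  then have hits: "\<forall>p \<in> P. R p \<inter> S \<noteq> {}"
    using \<open>finite P\<close> by auto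
  \<comment> \<open>Here \<open>c \<le> 1\<close> absorbs the rounding of \<open>k\<close>.\<close>
  have "1 \<le> 1 / c"
    using assms by simp
  then have "real (card S) \<le> (1 + ln m) / c"
    using S k by (simp add: add_divide_distrib)
  with S hits show ?thesis
    by (intro exI[of _ S] conjI)
qed

text \<open>With at least two vertices a resolving set cannot be empty, so the positivity
  requirement in \<^const>\<open>metric_dimension\<close> is met automatically.\<close>

lemma metric_dimension_le_card:
  assumes "finite (verts G)" "2 \<le> card (verts G)" "S \<subseteq> verts G"
    and separates: "\<And>x y. x \<in> verts G \<Longrightarrow> y \<in> verts G \<Longrightarrow> x \<noteq> y \<Longrightarrow>
           \<exists>z \<in> S. path_dist G z x \<noteq> path_dist G z y"
  shows "metric_dimension G \<le> card S"
proof -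
  have "finite S"
    using assms finite_subset by blast
  then obtain us where us: "set us = S" "distinct us"
    using finite_distinct_list by blast
  have "resolving G us"
    unfolding resolving_def
  proof (intro conjI inj_onI)
    fix x y assume "x \<in> verts G" "y \<in> verts G"
      and "map (\<lambda>u. path_dist G u x) us = map (\<lambda>u. path_dist G u y) us"
    then show "x = y"
      using separates[of x y] us by auto
  qed (use us assms in auto)
  moreover have "0 < card S"
  proof -
    obtain x y where "x \<in> verts G" "y \<in> verts G" "x \<noteq> y"
      using assms(2) card_le_Suc0_iff_eq[OF assms(1)] by fastforce
    then have "S \<noteq> {}"
      using separates by blast
    with \<open>finite S\<close> show ?thesis
      by (simp add: card_gt_0_iff)
  qed
  ultimately show ?thesis
    unfolding metric_dimension_def using us distinct_card[of us] by (intro Least_le) auto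
qed

theorem theorem10:
  fixes G :: "('a, 'b) pre_digraph" and c :: real
  assumes "oriented_digraph G"
    and "2 \<le> card (verts G)"
    and "0 < c"
    and "\<And>x y. x \<in> verts G \<Longrightarrow> y \<in> verts G \<Longrightarrow> x \<noteq> y \<Longrightarrow>
           c * real (card (verts G))
             \<le> real (card {z \<in> verts G. path_dist G z x \<noteq> path_dist G z y})"
  shows "real (metric_dimension G) \<le> (1 + 2 * ln (real (card (verts G)))) / c"
proof -
  interpret oriented_digraph G
    by (rule assms(1))
  define V where "V = verts G"
  define n where "n = real (card V)"
  define P where "P = {(x, y). x \<in> V \<and> y \<in> V \<and> x \<noteq> y}"
  define R where "R = (\<lambda>(x, y). {z \<in> V. path_dist G z x \<noteq> path_dist G z y})"
  have "finite V" "V \<noteq> {}"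
    using assms(2) by (auto simp: V_def)
  have n: "2 \<le> n"
    using assms(2) by (simp add: n_def V_def)
  obtain x y where xy: "x \<in> V" "y \<in> V" "x \<noteq> y"
    using assms(2) card_le_Suc0_iff_eq[OF \<open>finite V\<close>] unfolding V_def by fastforce
  have "P \<subset> V \<times> V"
    using xy by (auto simp: P_def)
  moreover have "finite (V \<times> V)"
    using \<open>finite V\<close> by simp
  ultimately have P: "finite P" "card P < card (V \<times> V)"
    by (meson finite_subset psubset_imp_subset, meson psubset_card_mono)
  have "c * n \<le> real (card {z \<in> V. path_dist G z x \<noteq> path_dist G z y})"
    using assms(4) xy by (simp add: n_def V_def)
  also have "\<dots> \<le> n"
    using \<open>finite V\<close> by (auto simp: n_def intro: card_mono)
  finally have "c \<le> 1"
    using n by simp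
  have few_pairs: "real (card P) < n\<^sup>2"
    using P(2) by (simp add: n_def card_cartesian_product power2_eq_square flip: of_nat_mult)
  have "1 \<le> n\<^sup>2"
    using n by simp
  have R: "R p \<subseteq> V" "c * real (card V) \<le> real (card (R p))" if "p \<in> P" for p
    using that assms(4) by (auto simp: P_def R_def V_def)
  have "\<exists>S \<subseteq> V. real (card S) \<le> (1 + ln (n\<^sup>2)) / c \<and> (\<forall>p \<in> P. R p \<inter> S \<noteq> {})"
    by (rule small_hitting_set)
      (fact \<open>finite V\<close> \<open>V \<noteq> {}\<close> P(1) \<open>0 < c\<close> \<open>c \<le> 1\<close> R few_pairs \<open>1 \<le> n\<^sup>2\<close>)+
  then obtain S where S: "S \<subseteq> V" "real (card S) \<le> (1 + ln (n\<^sup>2)) / c"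
    and hits: "\<forall>p \<in> P. R p \<inter> S \<noteq> {}"
    by (elim exE conjE)
  have "metric_dimension G \<le> card S"
  proof (rule metric_dimension_le_card)
    fix x y assume "x \<in> verts G" "y \<in> verts G" "x \<noteq> y"
    then show "\<exists>z \<in> S. path_dist G z x \<noteq> path_dist G z y"
      using bspec[OF hits, of "(x, y)"] by (auto simp: P_def R_def V_def)
  qed (use S assms(2) in \<open>auto simp: V_def\<close>)
  then have "real (metric_dimension G) \<le> (1 + ln (n\<^sup>2)) / c"
    using S(2) by linarith
  then show ?thesis
    using n by (simp add: ln_realpow n_def V_def)
qed

end
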